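(* Let $p$ be an odd prime, let $r,n\ge1$ be integers and let $a\in\mathbb{F}_{p^n}^*$. Then the function $f:\mathbb{F}_{p^n}\to\mathbb{F}_p$, $f(x)=\mathrm{Tr}_n(ax^{p^r+1})$, is not near-bent.
   Context: $\epsilon_p=e^{2\pi i/p}$, $\mathrm{Tr}_n$ is the absolute trace $\mathbb{F}_{p^n}\to\mathbb{F}_p$, $\widehat{f}(b)=\sum_{x\in\mathbb{F}_{p^n}}\epsilon_p^{f(x)-\mathrm{Tr}_n(bx)}$. A function $f:\mathbb{F}_{p^n}\to\mathbb{F}_p$ is near-bent if $|\widehat{f}(b)|^2\in\{0,p^{n+1}\}$ for all $b\in\mathbb{F}_{p^n}$. *)

theory Defs
  imports Complex_Main "HOL-Computational_Algebra.Primes"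
begin

text \<open>The finite field F_{p^n} is modelled by a finite field type 'a with
  CHAR('a) = p and CARD('a) = p^n.  The prime field F_p is the image of
  of_nat inside 'a; functions into F_p are functions 'a => 'a with values in it.\<close>

definition abs_trace :: "nat \<Rightarrow> nat \<Rightarrow> 'a::field \<Rightarrow> 'a" where
  "abs_trace p n x = (\<Sum>i<n. x ^ (p ^ i))"

definition fp_rep :: "nat \<Rightarrow> 'a::field \<Rightarrow> nat" where
  "fp_rep p y = (THE k. k < p \<and> of_nat k = y)"

definition eps_pow :: "nat \<Rightarrow> 'a::field \<Rightarrow> complex" where
  "eps_pow p y = cis (2 * pi * real (fp_rep p y) / real p)"

definition walsh :: "nat \<Rightarrow> nat \<Rightarrow> ('a::{field,finite} \<Rightarrow> 'a) \<Rightarrow> 'a \<Rightarrow> complex" where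
  "walsh p n f b = (\<Sum>x\<in>UNIV. eps_pow p (f x - abs_trace p n (b * x)))"

definition near_bent :: "nat \<Rightarrow> nat \<Rightarrow> ('a::{field,finite} \<Rightarrow> 'a) \<Rightarrow> bool" where
  "near_bent p n f \<longleftrightarrow>
     (\<forall>b. (cmod (walsh p n f b))\<^sup>2 \<in> {0, real p ^ (n + 1)})"

end

theory Submission
  imports Defs "HOL-Computational_Algebra.Polynomial" "HOL-Number_Theory.Cong"
begin

(* Put q = p^r, F x = Tr(a x^(q+1)) and let B y z = Tr(a (y^q z + y z^q))
   be the polar form of the quadratic form F, with radical Rad = {z. B y z = 0 for all y}.
   Expanding |W_F(0)|^2 as a double character sum and substituting x = y + z gives
   |W_F(0)|^2 = |Rad| * p^n, so near-bentness would force |Rad| = 0 or |Rad| = p.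
   The radical contains 0, so |Rad| = p would make Rad = F_p * z0 for some z0 \<noteq> 0.
   But Rad is stable under multiplication by every c with c^(q^2) = c, and for z0 in Rad
   the nondegeneracy of the trace yields (a z0)^(q^(n-1)) = -a z0^q, whence
   w = a z0^(q+1) satisfies w^q = -w: w is an element of F_(q^2) outside F_p
   (as p is odd), contradicting Rad = F_p * z0.  The argument does not use r >= 1. *)

text \<open>Every element of a finite field is a root of x^|K| - x.  (The library proves this for
  the class finite_field, which requires a prime characteristic instance; here the field is
  only assumed to be of class field + finite.)\<close>
lemma finite_field_pow_card:
  fixes x :: "'a :: {field,finite}"
  shows "x ^ card (UNIV :: 'a set) = x"
proof (cases "x = 0")
  case False
  have "x * (\<Prod>y\<in>UNIV-{0}. x * y) = x * x ^ (card (UNIV :: 'a set) - 1) * \<Prod>(UNIV-{0})"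
    by (simp add: prod.distrib mult_ac)
  also have "x * x ^ (card (UNIV :: 'a set) - 1) = x ^ Suc (card (UNIV :: 'a set) - 1)"
    by (subst power_Suc) auto
  also have "Suc (card (UNIV :: 'a set) - 1) = card (UNIV :: 'a set)"
    using finite_UNIV_card_ge_0[where ?'a = 'a] by simp
  also have "(\<Prod>y\<in>UNIV-{0}. x * y) = (\<Prod>y\<in>UNIV-{0}. y)"
    by (rule prod.reindex_bij_witness[of _ "\<lambda>y. y / x" "\<lambda>y. x * y"]) (use False in auto)
  finally show ?thesis
    by simp
qed (use finite_UNIV_card_ge_0[where ?'a = 'a] in auto)

text \<open>The setting: a finite field 'a of odd characteristic p with p^n elements.
  The prime field F_p is the set of fixed points of x \<mapsto> x^p.\<close>
locale odd_char_field =
  fixes p n :: nat and TY :: "'a::{field,finite} itself"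
  assumes prime_p: "prime p" and odd_p: "odd p" and char_p: "CHAR('a) = p"
    and card_field: "card (UNIV :: 'a set) = p ^ n" and n_pos: "n \<ge> 1"
begin

lemma p_gt_2: "p > 2"
  using prime_p odd_p prime_ge_2_nat[OF prime_p] by (cases "p = 2") auto

lemma two_nonzero: "(2::'a) \<noteq> 0"
proof
  assume "(2::'a) = 0"
  hence "(of_nat 2 :: 'a) = 0" by simp
  hence "CHAR('a) dvd 2" by (simp only: of_nat_eq_0_iff_char_dvd)
  thus False using char_p p_gt_2 by (auto dest: dvd_imp_le)
qed

subsection \<open>Frobenius and the prime field\<close>

lemma frobenius_add: "((x::'a) + y) ^ (p ^ k) = x ^ (p ^ k) + y ^ (p ^ k)"
  by (rule freshmans_dream') (use prime_p char_p in auto)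

lemma frobenius_sum: "(\<Sum>i\<in>A. (f i :: 'a)) ^ (p ^ k) = (\<Sum>i\<in>A. f i ^ (p ^ k))"
  using p_gt_2 by (induct A rule: infinite_finite_induct) (auto simp: frobenius_add)

lemma frobenius_period: "(x::'a) ^ (p ^ n) = x"
  using finite_field_pow_card[of x] card_field by simp

lemma frobenius_period_power: "(x::'a) ^ ((p ^ n) ^ k) = x"
proof (induction k)
  case (Suc k)
  have "x ^ ((p ^ n) ^ Suc k) = (x ^ ((p ^ n) ^ k)) ^ (p ^ n)"
    by (simp only: power_Suc2 power_mult)
  then show ?case using Suc frobenius_period by simp
qed simp

lemma of_nat_frobenius_fixed: "(of_nat k :: 'a) ^ p = of_nat k"
proof (induction k)
  case 0 then show ?case using p_gt_2 by simp
next
  case (Suc k)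
  have "(of_nat (Suc k) :: 'a) ^ p = (of_nat k + 1) ^ (p ^ 1)" by (simp add: add.commute)
  also have "\<dots> = of_nat k ^ p + 1" by (subst frobenius_add) simp
  finally show ?case using Suc by (simp add: add.commute)
qed

lemma of_nat_inj_below_p: "j < p \<Longrightarrow> k < p \<Longrightarrow> (of_nat j :: 'a) = of_nat k \<Longrightarrow> j = k"
  using of_nat_eq_iff_cong_CHAR[where 'a='a, of j k] char_p by (simp add: cong_def)

text \<open>The fixed points of Frobenius are exactly 0, 1, ..., p-1: there are at most p roots
  of x^p - x, and these p elements are roots.\<close>
lemma frobenius_fixed_in_prime_field:
  assumes "(y::'a) ^ p = y"
  shows "y \<in> (of_nat :: nat \<Rightarrow> 'a) ` {..<p}"
proof -
  define P :: "'a poly" where "P = monom 1 p - [:0,1:]"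
  have poly_P: "poly P x = x ^ p - x" for x by (simp add: P_def poly_monom)
  have "coeff P p = 1" using p_gt_2 by (simp add: P_def coeff_pCons split: nat.split)
  hence "P \<noteq> 0" by auto
  hence "card {x. poly P x = 0} \<le> degree P" by (rule card_poly_roots_bound)
  also have "degree P \<le> p" unfolding P_def
    by (rule order.trans[OF degree_diff_le]) (use p_gt_2 in \<open>auto simp: degree_monom_eq\<close>)
  finally have roots_le: "card {x. poly P x = 0} \<le> p" .
  have card_image: "card ((of_nat :: nat \<Rightarrow> 'a) ` {..<p}) = p"
    by (subst card_image) (auto intro: inj_onI of_nat_inj_below_p)
  have sub: "(of_nat :: nat \<Rightarrow> 'a) ` {..<p} \<subseteq> {x. poly P x = 0}"
    using of_nat_frobenius_fixed by (auto simp: poly_P)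
  have "(of_nat :: nat \<Rightarrow> 'a) ` {..<p} = {x. poly P x = 0}"
    by (rule card_subset_eq) (use card_mono[OF _ sub] roots_le card_image sub in auto)
  thus ?thesis using assms by (simp add: poly_P)
qed

lemma fp_rep_spec:
  assumes "(y::'a) ^ p = y"
  shows "fp_rep p y < p \<and> of_nat (fp_rep p y) = y"
proof -
  obtain k where k: "k < p" "of_nat k = y" using frobenius_fixed_in_prime_field[OF assms] by auto
  have "\<exists>!k. k < p \<and> of_nat k = y" using k of_nat_inj_below_p by blast
  thus ?thesis unfolding fp_rep_def by (rule theI')
qed

lemma frobenius_fixed_add: "(u::'a) ^ p = u \<Longrightarrow> v ^ p = v \<Longrightarrow> (u + v) ^ p = u + v"
  using frobenius_add[of u v 1] by simp

lemma frobenius_fixed_neg: "(u::'a) ^ p = u \<Longrightarrow> (- u) ^ p = - u"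
  using odd_p by (simp add: power_minus_odd)

lemma frobenius_fixed_power: "(w::'a) ^ p = w \<Longrightarrow> w ^ (p ^ k) = w"
proof (induction k)
  case (Suc k)
  have "w ^ (p ^ Suc k) = (w ^ (p ^ k)) ^ p" by (simp only: power_Suc2 power_mult)
  thus ?case using Suc by simp
qed simp

subsection \<open>The additive character of the prime field\<close>

lemma cis_mod_p: "cis (2*pi*real m / real p) = cis (2*pi*real (m mod p) / real p)"
proof -
  have m: "real m = real (m mod p) + real p * real (m div p)"
    by (metis mod_mult_div_eq of_nat_add of_nat_mult)
  have "2*pi*real m / real p = 2*pi*real (m mod p) / real p + 2*pi*real (m div p)"
    using p_gt_2 by (simp add: m field_simps)
  hence "cis (2*pi*real m / real p) = cis (2*pi*real (m mod p) / real p) * cis (2*pi*real (m div p))"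
    by (simp only: cis_mult)
  moreover have "cis (2*pi*real (m div p)) = 1" by (rule cis_multiple_2pi) simp
  ultimately show ?thesis by simp
qed

lemma eps_add:
  assumes "(u::'a) ^ p = u" "v ^ p = v"
  shows "eps_pow p (u + v) = eps_pow p u * eps_pow p v"
proof -
  define ku kv ks where "ku = fp_rep p u" and "kv = fp_rep p v" and "ks = fp_rep p (u + v)"
  have hu: "of_nat ku = u" using fp_rep_spec[OF assms(1)] ku_def by auto
  have hv: "of_nat kv = v" using fp_rep_spec[OF assms(2)] kv_def by auto
  have hs: "ks < p" "of_nat ks = u + v"
    using fp_rep_spec[OF frobenius_fixed_add[OF assms]] ks_def by auto
  have "(of_nat ks :: 'a) = of_nat (ku + kv)" using hu hv hs by simp
  hence "[ks = ku + kv] (mod CHAR('a))" by (simp only: of_nat_eq_iff_cong_CHAR)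
  hence "[ks = ku + kv] (mod p)" using char_p by simp
  hence ks_eq: "ks = (ku + kv) mod p" using hs(1) by (simp add: cong_def)
  have "eps_pow p u * eps_pow p v = cis (2*pi*real (ku+kv) / real p)"
    unfolding eps_pow_def ku_def[symmetric] kv_def[symmetric]
    by (simp add: cis_mult add_divide_distrib distrib_left)
  also have "\<dots> = eps_pow p (u + v)"
    unfolding eps_pow_def ks_def[symmetric] ks_eq by (rule cis_mod_p)
  finally show ?thesis by simp
qed

lemma eps_zero: "eps_pow p (0::'a) = 1"
proof -
  have "of_nat (fp_rep p (0::'a)) = (0::'a)" "fp_rep p (0::'a) < p"
    using fp_rep_spec[of 0] p_gt_2 by simp_all
  hence "fp_rep p (0::'a) = 0" using of_nat_inj_below_p[of "fp_rep p (0::'a)" 0] p_gt_2 by auto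
  thus ?thesis by (simp add: eps_pow_def)
qed

text \<open>The character is nontrivial: its kernel on F_p is {0}, since the p-th roots of
  unity cis(2 pi k/p), k < p, are pairwise distinct.\<close>
lemma eps_eq_1_imp_zero:
  assumes "(u::'a) ^ p = u" "eps_pow p u = 1"
  shows "u = 0"
proof -
  define k where "k = fp_rep p u"
  have hk: "k < p" "of_nat k = u" using fp_rep_spec[OF assms(1)] k_def by auto
  have inj: "inj_on (\<lambda>k. cis (2 * pi * real k / real p)) {..<p}"
    using bij_betw_roots_unity[of p] p_gt_2 by (auto simp: bij_betw_def)
  have "cis (2 * pi * real k / real p) = cis (2 * pi * real 0 / real p)"
    using assms(2) by (simp add: eps_pow_def k_def)
  hence "k = 0" using inj_onD[OF inj] hk p_gt_2 by auto
  thus ?thesis using hk by simp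
qed

lemma eps_cnj:
  assumes "(u::'a) ^ p = u"
  shows "cnj (eps_pow p u) = eps_pow p (- u)"
proof -
  have "eps_pow p (- u) * eps_pow p u = 1"
    using eps_add[OF frobenius_fixed_neg[OF assms] assms] eps_zero by simp
  moreover have "cnj (eps_pow p u) * eps_pow p u = 1"
    by (simp add: eps_pow_def cis_cnj cis_mult)
  ultimately show ?thesis
    by (metis eps_pow_def cis_neq_zero mult_cancel_right)
qed

text \<open>Orthogonality: the character sum of an additive map into F_p is |K| if the map
  vanishes identically and 0 otherwise (shifting by y0 with l y0 \<noteq> 0 multiplies
  the sum by eps_pow p (l y0) \<noteq> 1).\<close>
lemma additive_character_sum:
  fixes l :: "'a \<Rightarrow> 'a"
  assumes fixed: "\<And>y. l y ^ p = l y" and additive: "\<And>x y. l (x + y) = l x + l y"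
  shows "(\<Sum>y\<in>UNIV. eps_pow p (l y)) = (if \<forall>y. l y = 0 then of_nat (p ^ n) else 0)"
proof (cases "\<forall>y. l y = 0")
  case True
  thus ?thesis by (simp add: eps_zero card_field)
next
  case False
  then obtain y0 where y0: "l y0 \<noteq> 0" by auto
  define S where "S = (\<Sum>y\<in>UNIV. eps_pow p (l y))"
  have "S = (\<Sum>y\<in>UNIV. eps_pow p (l (y + y0)))"
    unfolding S_def by (rule sum.reindex_bij_witness[of _ "\<lambda>y. y + y0" "\<lambda>y. y - y0"]) auto
  also have "\<dots> = S * eps_pow p (l y0)"
    by (simp add: S_def additive eps_add fixed sum_distrib_right)
  finally have "S * (1 - eps_pow p (l y0)) = 0" by (simp add: algebra_simps)
  moreover have "eps_pow p (l y0) \<noteq> 1" using eps_eq_1_imp_zero[OF fixed] y0 by auto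
  ultimately have "S = 0" by simp
  thus ?thesis using False by (simp only: S_def if_False)
qed

subsection \<open>The absolute trace\<close>

abbreviation Tr :: "'a \<Rightarrow> 'a" where "Tr \<equiv> abs_trace p n"

lemma trace_add: "Tr (x + y) = Tr x + Tr y"
  by (simp add: abs_trace_def frobenius_add sum.distrib)

lemma trace_zero: "Tr 0 = 0"
  using p_gt_2 by (simp add: abs_trace_def power_0_left)

text \<open>Applying Frobenius to the summands of the trace permutes them cyclically.\<close>
lemma trace_shift: "(\<Sum>i<n. (x::'a) ^ (p ^ Suc i)) = Tr x"
proof -
  have "(\<Sum>i<Suc n. x ^ (p ^ i)) = x ^ (p ^ 0) + (\<Sum>i<n. x ^ (p ^ Suc i))"
    by (rule sum.lessThan_Suc_shift)
  moreover have "(\<Sum>i<Suc n. x ^ (p ^ i)) = (\<Sum>i<n. x ^ (p ^ i)) + x ^ (p ^ n)"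
    by simp
  ultimately show ?thesis using frobenius_period by (simp add: abs_trace_def)
qed

lemma trace_in_prime_field: "Tr x ^ p = Tr x"
proof -
  have "Tr x ^ p = Tr x ^ (p ^ 1)" by simp
  also have "\<dots> = (\<Sum>i<n. (x ^ (p ^ i)) ^ (p ^ 1))"
    unfolding abs_trace_def by (rule frobenius_sum)
  also have "\<dots> = (\<Sum>i<n. x ^ (p ^ Suc i))" by (simp add: power_mult[symmetric] mult.commute)
  finally show ?thesis using trace_shift by simp
qed

lemma trace_frobenius: "Tr (x ^ (p ^ k)) = Tr x"
proof (induction k)
  case (Suc k)
  have "Tr (y ^ p) = Tr y" for y :: 'a
    using trace_shift[of y] unfolding abs_trace_def by (simp add: power_mult[symmetric])
  moreover have "x ^ (p ^ Suc k) = (x ^ (p ^ k)) ^ p" by (simp only: power_Suc2 power_mult)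
  ultimately show ?case using Suc by simp
qed simp

text \<open>The trace form (u, c) \<mapsto> Tr(u c) is nondegenerate: otherwise Tr would vanish on
  all of K, but it is a nonzero polynomial of degree p^(n-1) < p^n.\<close>
lemma trace_nondegenerate:
  assumes "\<And>c. Tr (u * c) = 0"
  shows "u = 0"
proof (rule ccontr)
  assume u: "u \<noteq> 0"
  have trace_vanishes: "Tr c = 0" for c using assms[of "c / u"] u by simp
  define P :: "'a poly" where "P = (\<Sum>i<n. monom 1 (p ^ i))"
  have poly_P: "poly P x = Tr x" for x by (simp add: P_def poly_sum poly_monom abs_trace_def)
  have pow_inj: "p ^ i = p ^ j \<longleftrightarrow> i = j" for i j using p_gt_2 by (simp add: power_inject_exp)
  have "coeff P (p ^ (n - 1)) = (\<Sum>i<n. if p ^ (n - 1) = p ^ i then 1 else 0)"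
    by (simp add: P_def coeff_sum coeff_monom eq_commute)
  also have "\<dots> = (\<Sum>i\<in>{n - 1}. 1)"
    by (rule sum.mono_neutral_cong_right) (use n_pos pow_inj in auto)
  finally have "P \<noteq> 0" by auto
  have "degree P \<le> p ^ (n - 1)"
  proof (rule degree_le, intro allI impI)
    fix j assume j: "p ^ (n - 1) < j"
    have "p ^ i \<noteq> j" if "i < n" for i
      using j power_increasing[of i "n - 1" p] that p_gt_2 by auto
    thus "coeff P j = 0" by (simp add: P_def coeff_sum coeff_monom)
  qed
  moreover have "card {x. poly P x = 0} \<le> degree P" by (rule card_poly_roots_bound[OF \<open>P \<noteq> 0\<close>])
  moreover have "{x. poly P x = 0} = UNIV" using trace_vanishes poly_P by auto
  moreover have "p ^ (n - 1) < p ^ n" using p_gt_2 n_pos by (intro power_strict_increasing) auto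
  ultimately show False using card_field by simp
qed

subsection \<open>The Walsh value at 0 of a quadratic form\<close>

text \<open>Let Q be an F_p-valued function with biadditive polar form P, i.e.
  Q(y + z) = Q y + Q z + P y z, vanishing on the radical of P.  Then the squared absolute
  value of its character sum is |radical| * p^n: substitute x = y + z in the double sum
  and apply orthogonality to the inner sum over y.\<close>
lemma quadratic_character_sum_square:
  fixes Q :: "'a \<Rightarrow> 'a" and P :: "'a \<Rightarrow> 'a \<Rightarrow> 'a"
  assumes Q_fixed: "\<And>x. Q x ^ p = Q x" and P_fixed: "\<And>y z. P y z ^ p = P y z"
    and polar: "\<And>y z. Q (y + z) = Q y + Q z + P y z"
    and P_add: "\<And>y1 y2 z. P (y1 + y2) z = P y1 z + P y2 z"
    and Q_radical: "\<And>z. \<forall>y. P y z = 0 \<Longrightarrow> Q z = 0"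
  defines "W \<equiv> \<Sum>x\<in>UNIV. eps_pow p (Q x)"
  shows "W * cnj W = of_nat (card {z. \<forall>y. P y z = 0} * p ^ n)"
proof -
  define R where "R = {z. \<forall>y. P y z = 0}"
  have "cnj W = (\<Sum>y\<in>UNIV. eps_pow p (- Q y))" by (simp add: W_def eps_cnj Q_fixed)
  hence "W * cnj W = (\<Sum>x\<in>UNIV. \<Sum>y\<in>UNIV. eps_pow p (Q x) * eps_pow p (- Q y))"
    unfolding W_def by (simp only: sum_product)
  also have "\<dots> = (\<Sum>y\<in>UNIV. \<Sum>x\<in>UNIV. eps_pow p (Q x) * eps_pow p (- Q y))"
    by (rule sum.swap)
  also have "\<dots> = (\<Sum>y\<in>UNIV. \<Sum>z\<in>UNIV. eps_pow p (Q (y + z)) * eps_pow p (- Q y))"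
  proof (rule sum.cong[OF refl])
    fix y
    show "(\<Sum>x\<in>UNIV. eps_pow p (Q x) * eps_pow p (- Q y))
        = (\<Sum>z\<in>UNIV. eps_pow p (Q (y + z)) * eps_pow p (- Q y))"
      by (rule sum.reindex_bij_witness[of _ "\<lambda>z. y + z" "\<lambda>x. x - y"]) simp_all
  qed
  also have "\<dots> = (\<Sum>y\<in>UNIV. \<Sum>z\<in>UNIV. eps_pow p (Q z) * eps_pow p (P y z))"
  proof (intro sum.cong refl)
    fix y z
    have "eps_pow p (Q (y + z)) * eps_pow p (- Q y) = eps_pow p (Q (y + z) + - Q y)"
      by (rule eps_add[symmetric]) (simp_all add: Q_fixed frobenius_fixed_neg)
    also have "Q (y + z) + - Q y = Q z + P y z" by (simp add: polar)
    also have "eps_pow p (Q z + P y z) = eps_pow p (Q z) * eps_pow p (P y z)"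
      by (rule eps_add) (simp_all add: Q_fixed P_fixed)
    finally show "eps_pow p (Q (y + z)) * eps_pow p (- Q y) = \<dots>" .
  qed
  also have "\<dots> = (\<Sum>z\<in>UNIV. eps_pow p (Q z) * (\<Sum>y\<in>UNIV. eps_pow p (P y z)))"
    by (subst sum.swap) (simp add: sum_distrib_left)
  also have "\<dots> = (\<Sum>z\<in>UNIV. if z \<in> R then of_nat (p ^ n) else 0)"
  proof (rule sum.cong[OF refl])
    fix z
    have "(\<Sum>y\<in>UNIV. eps_pow p (P y z)) = (if \<forall>y. P y z = 0 then of_nat (p ^ n) else 0)"
      by (rule additive_character_sum) (simp_all add: P_fixed P_add)
    thus "eps_pow p (Q z) * (\<Sum>y\<in>UNIV. eps_pow p (P y z))
        = (if z \<in> R then of_nat (p ^ n) else 0)"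
      using Q_radical[of z] by (simp add: eps_zero R_def)
  qed
  also have "\<dots> = (\<Sum>z\<in>UNIV \<inter> R. of_nat (p ^ n))"
    by (rule sum.inter_restrict[symmetric]) simp
  also have "\<dots> = of_nat (card R * p ^ n)" by simp
  finally show ?thesis by (simp only: R_def)
qed

end

subsection \<open>The quadratic form Tr(a x^(p^r+1)) and its radical\<close>

locale gold_form = odd_char_field p n TY for p n :: nat and TY :: "'a::{field,finite} itself" +
  fixes a :: 'a and r :: nat
  assumes a_nonzero: "a \<noteq> 0"
begin

abbreviation q where "q \<equiv> p ^ r"

definition F :: "'a \<Rightarrow> 'a" where "F x = Tr (a * x ^ (q + 1))"

definition B :: "'a \<Rightarrow> 'a \<Rightarrow> 'a" where "B y z = Tr (a * (y ^ q * z + y * z ^ q))"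

definition radical :: "'a set" where "radical = {z. \<forall>y. B y z = 0}"

lemma F_polar: "F (y + z) = F y + F z + B y z"
proof -
  have "(y + z) ^ (q + 1) = (y ^ q + z ^ q) * (y + z)" by (simp add: frobenius_add)
  hence "a * (y + z) ^ (q + 1) = a * y ^ (q + 1) + a * z ^ (q + 1) + a * (y ^ q * z + y * z ^ q)"
    by (simp add: algebra_simps)
  thus ?thesis by (simp add: F_def B_def trace_add)
qed

lemma B_add: "B (y1 + y2) z = B y1 z + B y2 z"
proof -
  have "a * ((y1 + y2) ^ q * z + (y1 + y2) * z ^ q)
        = a * (y1 ^ q * z + y1 * z ^ q) + a * (y2 ^ q * z + y2 * z ^ q)"
    by (simp add: frobenius_add algebra_simps)
  thus ?thesis by (simp add: B_def trace_add)
qed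

lemma B_sym: "B y z = B z y"
  by (simp add: B_def algebra_simps)

text \<open>Since B z z = 2 F z and 2 \<noteq> 0, F vanishes on the radical.\<close>
lemma F_radical: "z \<in> radical \<Longrightarrow> F z = 0"
proof -
  assume "z \<in> radical"
  hence "B z z = 0" by (simp add: radical_def)
  moreover have "a * (z ^ q * z + z * z ^ q) = a * z ^ (q + 1) + a * z ^ (q + 1)"
    by (simp add: algebra_simps)
  hence "B z z = F z + F z" unfolding B_def F_def by (simp only: trace_add)
  ultimately have "2 * F z = 0" by simp
  thus "F z = 0" using two_nonzero by simp
qed

lemma walsh_zero_square: "(cmod (walsh p n F 0))\<^sup>2 = real (card radical * p ^ n)"
proof -
  have F_fixed: "F x ^ p = F x" for x by (simp add: F_def trace_in_prime_field)
  have B_fixed: "B y z ^ p = B y z" for y z by (simp add: B_def trace_in_prime_field)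
  have F_zero: "\<forall>y. B y z = 0 \<Longrightarrow> F z = 0" for z by (simp add: F_radical radical_def)
  have "walsh p n F 0 = (\<Sum>x\<in>UNIV. eps_pow p (F x))" by (simp add: walsh_def trace_zero)
  moreover have "(\<Sum>x\<in>UNIV. eps_pow p (F x)) * cnj (\<Sum>x\<in>UNIV. eps_pow p (F x))
      = of_nat (card radical * p ^ n)"
    unfolding radical_def
    by (rule quadratic_character_sum_square[of F B]) (simp_all add: F_fixed B_fixed F_polar B_add F_zero)
  ultimately have "complex_of_real ((cmod (walsh p n F 0))\<^sup>2) = of_nat (card radical * p ^ n)"
    by (simp only: complex_norm_square)
  thus ?thesis by (metis of_real_of_nat_eq of_real_eq_iff)
qed

lemma radical_zero: "0 \<in> radical"
  using p_gt_2 by (simp add: radical_def B_def trace_zero power_0_left)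

lemma radical_add: "z1 \<in> radical \<Longrightarrow> z2 \<in> radical \<Longrightarrow> z1 + z2 \<in> radical"
proof -
  have "B y (z1 + z2) = B y z1 + B y z2" for y by (simp only: B_sym[of y] B_add)
  thus "z1 \<in> radical \<Longrightarrow> z2 \<in> radical \<Longrightarrow> z1 + z2 \<in> radical" by (simp add: radical_def)
qed

lemma radical_of_nat_mult: "z \<in> radical \<Longrightarrow> of_nat k * z \<in> radical"
  by (induction k) (simp_all add: radical_zero radical_add distrib_right)

text \<open>q * q^(n-1) = q^n is a power of |K| = p^n, so x^(q * q^(n-1)) = x for every x.\<close>
lemma q_times_power: "q * q ^ (n - 1) = (p ^ n) ^ r"
proof -
  have "q * q ^ (n - 1) = q ^ n" using n_pos by (simp add: power_Suc[symmetric])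
  thus ?thesis by (simp add: power_mult[symmetric] mult.commute)
qed

text \<open>The radical is a vector space over F_(q^2): B (c^q y) z = B y (c z) when c^(q^2) = c.\<close>
lemma radical_scale:
  assumes c: "c ^ (q * q) = c" and z: "z \<in> radical"
  shows "c * z \<in> radical"
proof -
  have "B y (c * z) = 0" for y
  proof -
    have cq: "(c ^ q * y) ^ q = c * y ^ q"
      using c by (simp add: power_mult_distrib power_mult[symmetric])
    have "a * ((c ^ q * y) ^ q * z + c ^ q * y * z ^ q) = a * (y ^ q * (c * z) + y * (c * z) ^ q)"
      unfolding cq by (simp add: power_mult_distrib algebra_simps)
    hence "B (c ^ q * y) z = B y (c * z)" unfolding B_def by (rule arg_cong[where f = Tr])
    thus ?thesis using z by (simp add: radical_def)
  qed
  thus ?thesis by (simp add: radical_def)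
qed

text \<open>Membership in the radical, rewritten with the adjoint of x \<mapsto> x^q with respect to
  the trace form: Tr(u y^q) = Tr(u^(q^(n-1)) y), as (y^q)^(q^(n-1)) = y.\<close>
lemma radical_adjoint:
  assumes z: "z \<in> radical"
  shows "(a * z) ^ (q ^ (n - 1)) = - (a * z ^ q)"
proof -
  define Q where "Q = q ^ (n - 1)"
  have qQ: "q * Q = (p ^ n) ^ r" unfolding Q_def by (rule q_times_power)
  have "Tr (((a * z) ^ Q + a * z ^ q) * y) = 0" for y
  proof -
    have "Tr (a * (y ^ q * z)) = Tr ((a * (y ^ q * z)) ^ Q)"
      unfolding Q_def by (simp only: power_mult[symmetric] trace_frobenius)
    also have "(a * (y ^ q * z)) ^ Q = (a * z) ^ Q * y ^ (q * Q)"
      by (simp only: power_mult_distrib power_mult[symmetric] mult_ac)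
    also have "y ^ (q * Q) = y" unfolding qQ by (rule frobenius_period_power)
    finally have "Tr (a * (y ^ q * z)) = Tr ((a * z) ^ Q * y)" .
    moreover have "B y z = Tr (a * (y ^ q * z)) + Tr (a * z ^ q * y)"
      unfolding B_def by (simp add: trace_add[symmetric] algebra_simps)
    ultimately show ?thesis using z by (simp add: radical_def distrib_right trace_add)
  qed
  hence "(a * z) ^ Q + a * z ^ q = 0" by (rule trace_nondegenerate)
  thus ?thesis by (simp add: Q_def eq_neg_iff_add_eq_0)
qed

text \<open>Every nonzero z in the radical yields an element w = a z^(q+1) of F_(q^2) outside F_p:
  raising the adjoint relation to the q-th power gives w^q = -w.\<close>
lemma radical_witness:
  assumes z: "z \<in> radical" and z0: "z \<noteq> 0"
  defines "w \<equiv> a * z ^ (q + 1)"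
  shows "w ^ (q * q) = w" and "w ^ p \<noteq> w"
proof -
  have q_odd: "odd q" using odd_p by simp
  have "(a * z) ^ (q * q ^ (n - 1)) = ((a * z) ^ (q ^ (n - 1))) ^ q"
    by (simp only: mult.commute[of q] power_mult)
  hence "a * z = ((a * z) ^ (q ^ (n - 1))) ^ q"
    by (simp only: q_times_power frobenius_period_power)
  also have "\<dots> = - (a ^ q * z ^ (q * q))"
    unfolding radical_adjoint[OF z] using q_odd
    by (simp add: power_minus_odd power_mult_distrib power_mult)
  finally have az: "a ^ q * z ^ (q * q) = - (a * z)" by simp
  have "w ^ q = a ^ q * z ^ ((q + 1) * q)"
    by (simp only: w_def power_mult_distrib power_mult)
  also have "(q + 1) * q = q * q + q" by (simp add: algebra_simps)
  also have "a ^ q * z ^ (q * q + q) = (a ^ q * z ^ (q * q)) * z ^ q"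
    by (simp only: power_add mult.assoc)
  also have "\<dots> = - w" unfolding az by (simp add: w_def algebra_simps)
  finally have wq: "w ^ q = - w" .
  have "w ^ (q * q) = (w ^ q) ^ q" by (simp only: power_mult)
  also have "\<dots> = w" using q_odd wq by (simp add: power_minus_odd)
  finally show "w ^ (q * q) = w" .
  show "w ^ p \<noteq> w"
  proof
    assume "w ^ p = w"
    hence "w ^ q = w" by (rule frobenius_fixed_power)
    hence "2 * w = 0" using wq by simp
    thus False using two_nonzero a_nonzero z0 by (simp add: w_def)
  qed
qed

text \<open>If |radical| = p, the radical is the F_p-line through any nonzero z0 in it; by
  radical_scale this line would absorb F_(q^2) z0, forcing F_(q^2) \<subseteq> F_p, which
  radical_witness refutes.\<close>
lemma card_radical_ne_p: "card radical \<noteq> p"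
proof
  assume card_p: "card radical = p"
  have "radical \<noteq> {0}" using card_p p_gt_2 by auto
  then obtain z0 where z0: "z0 \<in> radical" "z0 \<noteq> 0" using radical_zero by blast
  define line where "line = (\<lambda>k. of_nat k * z0) ` {..<p}"
  have "card line = p" unfolding line_def
    by (subst card_image) (auto intro!: inj_onI intro: of_nat_inj_below_p simp: z0(2))
  hence line_eq: "line = radical"
    by (intro card_subset_eq) (use radical_of_nat_mult[OF z0(1)] card_p line_def in auto)
  have "c ^ p = c" if c: "c ^ (q * q) = c" for c :: 'a
  proof -
    obtain k where "c * z0 = of_nat k * z0"
      using radical_scale[OF c z0(1)] by (auto simp: line_eq[symmetric] line_def)
    thus ?thesis using z0(2) of_nat_frobenius_fixed by simp
  qed
  thus False using radical_witness[OF z0] by blast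
qed

end

theorem theorem3:
  fixes a :: "'a::{field,finite}" and p n r :: nat
  assumes "prime p" and "odd p"
    and "CHAR('a) = p" and "card (UNIV :: 'a set) = p ^ n"
    and "r \<ge> 1" and "n \<ge> 1"
    and "a \<noteq> 0"
  shows "\<not> near_bent p n (\<lambda>x. abs_trace p n (a * x ^ (p ^ r + 1)))"
proof
  interpret gold_form p n "TYPE('a)" a r by unfold_locales (use assms in auto)
  have "card radical \<noteq> 0"
    using radical_zero card_eq_0_iff[of radical] finite[of radical] by blast
  hence nonzero: "card radical * p ^ n \<noteq> 0" using p_gt_2 by simp
  assume "near_bent p n (\<lambda>x. abs_trace p n (a * x ^ (p ^ r + 1)))"
  hence "(cmod (walsh p n F 0))\<^sup>2 \<in> {0, real p ^ (n + 1)}"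
    by (simp add: near_bent_def F_def[abs_def])
  hence "card radical * p ^ n \<in> {0, p ^ (n + 1)}"
    unfolding walsh_zero_square of_nat_power[symmetric] by auto
  hence "card radical * p ^ n = p ^ (n + 1)" using nonzero by blast
  hence "card radical = p" using p_gt_2 by simp
  thus False using card_radical_ne_p by simp
qed

end
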